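(* Let $\mathbb{P}$ be a poset with least element $0$, let $Z\subseteq\mathbb{P}$ be a lower complete sublattice of $\mathbb{P}$ which is $\mathbb{P}$-central, and let $I\subseteq\mathbb{P}$ be $Z$-complete. Then $\mathrm{c}_ZI$ is an upper complete sublattice of $Z$. Moreover, $z=\bigvee_Z\mathrm{c}_ZI$ is the unique $z\in Z$ such that, for all $y\in Z$, $$y\wedge z=0\quad\Leftrightarrow\quad[0,y]\cap I=\{0\}.$$
   Context: Suprema $\bigvee,\vee$ and infima $\bigwedge,\wedge$ are taken in $\mathbb{P}$ and need not exist in general; any assertion such as $\bigvee S\in I$, $p=q\vee r$ or $y\wedge z=0$ includes the assertion that the supremum/infimum exists. $\bigvee_Z$ and $\vee_Z$ denote suprema in $Z$ (as a poset in the induced order), which may differ from suprema in $\mathbb{P}$. $[0,y]=\{p\in\mathbb{P}:p\leq y\}$. $Z\subseteq\mathbb{P}$ is a lower complete sublattice of $\mathbb{P}$ if every $S\subseteq Z$ has an infimum in $\mathbb{P}$ and this infimum belongs to $Z$ (in particular $\mathbb{P}$ has a greatest element $1=\bigwedge\emptyset\in Z$, and $Z$ is a complete lattice in its own right). A subset $J$ of a poset $Q$ is an upper complete sublattice of $Q$ if every $S\subseteq J$ has a supremum in $Q$ and this supremum belongs to $J$. For $p\in\mathbb{P}$ the $Z$-cover of $p$ is $\mathrm{c}_Z(p)=\bigwedge\{z\in Z:p\leq z\}\in Z$, and $\mathrm{c}_ZI=\{\mathrm{c}_Z(p):p\in I\}$. $Z$ is $\mathbb{P}$-central if for all $p\in\mathbb{P}$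 and $y\in Z$ there is $z\in Z$ with $y\wedge z=0$ and $p=q\vee r$ for some $q,r\in\mathbb{P}$ with $q\leq y$ and $r\leq z$. A set $S\subseteq\mathbb{P}$ is $Z$-disjoint if there is $f:S\to Z$ with $p\leq f(p)$ for all $p\in S$ and $f(p)\wedge f(q)=0$ for all distinct $p,q\in S$. A set $I\subseteq\mathbb{P}$ is $Z$-complete if (1) $\bigvee S\in I$ whenever $S\subseteq I$ is $Z$-disjoint, and (2) $p,q\in I$ whenever $p,q\in\mathbb{P}$, $p\vee q\in I$ and $\{p,q\}$ is $Z$-disjoint. *)

theory Defs
  imports "HOL-Library.Lub_Glb"
begin

text \<open>
  The poset is a type of class \<open>order_bot\<close>, with \<open>bot\<close> in the role of \<open>0\<close>. Suprema and infima
  need not exist, so they are expressed by the relations \<^const>\<open>isLub\<close> and \<^const>\<open>isGlb\<close> of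
  the library, whose first argument is the subset (with the induced order) in which the bound is
  formed: \<open>isLub UNIV\<close> and \<open>isGlb UNIV\<close> refer to the whole poset and \<open>isLub Z\<close> to \<open>Z\<close>.
  In particular \<open>isGlb UNIV {y, z} bot\<close> says that the infimum of \<open>y\<close> and \<open>z\<close> exists and is \<open>0\<close>.
\<close>

definition lower_complete_sublattice :: "'a::order set \<Rightarrow> bool" where
  "lower_complete_sublattice Z \<longleftrightarrow> (\<forall>S\<subseteq>Z. \<exists>x\<in>Z. isGlb UNIV S x)"

definition upper_complete_sublattice_of :: "'a::order set \<Rightarrow> 'a set \<Rightarrow> bool" where
  "upper_complete_sublattice_of Q J \<longleftrightarrow> J \<subseteq> Q \<and> (\<forall>S\<subseteq>J. \<exists>x\<in>J. isLub Q S x)"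

text \<open>
  Meaningful only if the infimum exists, as it does when \<open>Z\<close> is a lower complete sublattice.
\<close>

definition Z_cover :: "'a::order set \<Rightarrow> 'a \<Rightarrow> 'a" where
  "Z_cover Z p = (THE c. isGlb UNIV {z \<in> Z. p \<le> z} c)"

definition poset_central :: "'a::order_bot set \<Rightarrow> bool" where
  "poset_central Z \<longleftrightarrow>
    (\<forall>p. \<forall>y\<in>Z. \<exists>z\<in>Z. isGlb UNIV {y, z} bot \<and>
      (\<exists>q r. isLub UNIV {q, r} p \<and> q \<le> y \<and> r \<le> z))"

definition Z_disjoint :: "'a::order_bot set \<Rightarrow> 'a set \<Rightarrow> bool" where
  "Z_disjoint Z S \<longleftrightarrow>
    (\<exists>f. f ` S \<subseteq> Z \<and> (\<forall>p\<in>S. p \<le> f p) \<and>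
      (\<forall>p\<in>S. \<forall>q\<in>S. p \<noteq> q \<longrightarrow> isGlb UNIV {f p, f q} bot))"

definition Z_complete :: "'a::order_bot set \<Rightarrow> 'a set \<Rightarrow> bool" where
  "Z_complete Z I \<longleftrightarrow>
    (\<forall>S\<subseteq>I. Z_disjoint Z S \<longrightarrow> (\<exists>s\<in>I. isLub UNIV S s)) \<and>
    (\<forall>p q. (\<exists>s\<in>I. isLub UNIV {p, q} s) \<and> Z_disjoint Z {p, q} \<longrightarrow> p \<in> I \<and> q \<in> I)"

end

theory Submission
  imports Defs
begin

text \<open>
  Centrality splits any \<open>s \<in> I\<close> along \<open>y \<in> Z\<close> as \<open>s = q \<or> r\<close> with \<open>q \<le> y\<close> and \<open>r\<close> below an
  element of \<open>Z\<close> disjoint from \<open>y\<close>, and both pieces stay in \<open>I\<close>. Given \<open>S \<subseteq> I\<close>, let \<open>T\<close> be a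
  maximal \<open>Z\<close>-disjoint set of elements of \<open>I\<close> lying below all upper bounds of \<open>S\<close> in \<open>Z\<close>, and
  \<open>t = \<Or>T \<in> I\<close>. Splitting \<open>s \<in> S\<close> along the cover of \<open>t\<close>, the second piece could be added to
  \<open>T\<close> and thus vanishes, so the cover of \<open>t\<close> is the supremum of the covers of \<open>S\<close> in \<open>Z\<close>.
  The characterisation of \<open>z\<close> follows by splitting \<open>t\<close> along \<open>y\<close>, where \<open>t \<in> I\<close> has cover \<open>z\<close>,
  and uniqueness by splitting two candidates along each other.
\<close>

lemma isLub_iff:
  "isLub A S x \<longleftrightarrow> x \<in> A \<and> (\<forall>s\<in>S. s \<le> x) \<and> (\<forall>u\<in>A. (\<forall>s\<in>S. s \<le> u) \<longrightarrow> x \<le> u)"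
  by (auto simp: isLub_def leastP_def isUb_def setle_def setge_def)

lemma isGlb_iff:
  "isGlb A S x \<longleftrightarrow> x \<in> A \<and> (\<forall>s\<in>S. x \<le> s) \<and> (\<forall>u\<in>A. (\<forall>s\<in>S. u \<le> s) \<longrightarrow> u \<le> x)"
  by (auto simp: isGlb_def greatestP_def isLb_def setle_def setge_def)

lemma isGlb_pair_bot_iff:
  fixes y z :: "'a::order_bot"
  shows "isGlb UNIV {y, z} bot \<longleftrightarrow> (\<forall>p. p \<le> y \<longrightarrow> p \<le> z \<longrightarrow> p = bot)"
  by (auto simp: isGlb_iff bot_unique)

section \<open>Covers and \<open>Z\<close>-disjointness\<close>

context
  fixes Z :: "'a::order_bot set"
  assumes lower: "lower_complete_sublattice Z"
begin

lemma isGlb_Z_cover: "isGlb UNIV {z \<in> Z. p \<le> z} (Z_cover Z p)"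
  and Z_cover_in: "Z_cover Z p \<in> Z"
proof -
  obtain x where x: "x \<in> Z" "isGlb UNIV {z \<in> Z. p \<le> z} x"
    using lower unfolding lower_complete_sublattice_def
    by (metis (no_types, lifting) mem_Collect_eq subsetI)
  moreover have "Z_cover Z p = x"
    unfolding Z_cover_def
  proof (rule the_equality)
    show "c = x" if "isGlb UNIV {z \<in> Z. p \<le> z} c" for c
      using that x(2) unfolding isGlb_iff by (intro antisym) blast+
  qed (rule x(2))
  ultimately show "isGlb UNIV {z \<in> Z. p \<le> z} (Z_cover Z p)" "Z_cover Z p \<in> Z"
    by auto
qed

lemma le_Z_cover: "p \<le> Z_cover Z p"
  using isGlb_Z_cover[of p] by (auto simp: isGlb_iff)

lemma Z_cover_le_iff: "z \<in> Z \<Longrightarrow> Z_cover Z p \<le> z \<longleftrightarrow> p \<le> z"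
  using isGlb_Z_cover[of p] le_Z_cover[of p] by (auto simp: isGlb_iff)

text \<open>The cover is the smallest admissible value of \<open>f\<close>, and disjointness passes
  to smaller elements. Without the choice of \<open>f\<close>, \<open>Z\<close>-disjointness is a
  condition on pairs.\<close>

lemma Z_disjoint_iff:
  "Z_disjoint Z S \<longleftrightarrow>
    (\<forall>p\<in>S. \<forall>q\<in>S. p \<noteq> q \<longrightarrow> isGlb UNIV {Z_cover Z p, Z_cover Z q} bot)"
proof
  assume "Z_disjoint Z S"
  then obtain f where f: "f ` S \<subseteq> Z" "\<forall>p\<in>S. p \<le> f p"
    "\<forall>p\<in>S. \<forall>q\<in>S. p \<noteq> q \<longrightarrow> isGlb UNIV {f p, f q} bot"
    unfolding Z_disjoint_def by blast
  then have "Z_cover Z p \<le> f p" if "p \<in> S" for p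
    using that by (simp add: Z_cover_le_iff image_subset_iff)
  then show "\<forall>p\<in>S. \<forall>q\<in>S. p \<noteq> q \<longrightarrow> isGlb UNIV {Z_cover Z p, Z_cover Z q} bot"
    using f(3) unfolding isGlb_pair_bot_iff by (meson order_trans)
next
  assume "\<forall>p\<in>S. \<forall>q\<in>S. p \<noteq> q \<longrightarrow> isGlb UNIV {Z_cover Z p, Z_cover Z q} bot"
  then show "Z_disjoint Z S"
    unfolding Z_disjoint_def
    by (intro exI[of _ "Z_cover Z"]) (auto intro: Z_cover_in le_Z_cover)
qed

lemma Z_disjoint_pairI:
  assumes "y \<in> Z" "z \<in> Z" "isGlb UNIV {y, z} bot" "q \<le> y" "r \<le> z"
  shows "Z_disjoint Z {q, r}"
proof -
  have "Z_cover Z q \<le> y" "Z_cover Z r \<le> z"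
    using assms by (simp_all add: Z_cover_le_iff)
  then show ?thesis
    using assms(3) unfolding Z_disjoint_iff isGlb_pair_bot_iff
    by (metis insert_iff order_trans singletonD)
qed

text \<open>Zorn's lemma: the condition concerns only pairs, and any two elements of the union of a
  chain lie in a common member.\<close>

lemma maximal_Z_disjoint:
  obtains T where "T \<subseteq> A" "Z_disjoint Z T"
    "\<forall>X\<subseteq>A. Z_disjoint Z X \<longrightarrow> T \<subseteq> X \<longrightarrow> X = T"
proof -
  let ?D = "{T. T \<subseteq> A \<and> Z_disjoint Z T}"
  have "\<exists>T\<in>?D. \<forall>X\<in>?D. T \<subseteq> X \<longrightarrow> X = T"
  proof (rule subset_Zorn')
    fix C assume C: "subset.chain ?D C"
    have "isGlb UNIV {Z_cover Z p, Z_cover Z q} bot"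
      if pq: "p \<in> \<Union>C" "q \<in> \<Union>C" "p \<noteq> q" for p q
    proof -
      obtain X Y where "X \<in> C" "Y \<in> C" "p \<in> X" "q \<in> Y"
        using pq by blast
      then obtain W where "W \<in> C" "p \<in> W" "q \<in> W"
        using C unfolding subset_chain_def by (meson subsetD)
      then show ?thesis
        using C \<open>p \<noteq> q\<close> unfolding subset_chain_def Z_disjoint_iff by blast
    qed
    then show "\<Union>C \<in> ?D"
      using C by (auto simp: subset_chain_def Z_disjoint_iff)
  qed
  then show thesis
    using that by auto
qed

section \<open>Splitting along central elements\<close>

context
  assumes central: "poset_central Z"
begin

lemma central_split:
  assumes "y \<in> Z"
  obtains w q r where "w \<in> Z" "isGlb UNIV {y, w} bot" "isLub UNIV {q, r} p" "q \<le> y" "r \<le> w"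
proof -
  obtain w where w: "w \<in> Z" "isGlb UNIV {y, w} bot"
    "\<exists>q r. isLub UNIV {q, r} p \<and> q \<le> y \<and> r \<le> w"
    using assms central unfolding poset_central_def by metis
  from w(3) obtain q r where "isLub UNIV {q, r} p" "q \<le> y" "r \<le> w"
    by (elim exE conjE)
  then show thesis
    by (rule that[OF w(1,2)])
qed

text \<open>In the splitting of \<open>z\<close> along \<open>z'\<close>, the piece outside
  \<open>z'\<close> is below both \<open>z\<close> and \<open>w\<close>, hence \<open>bot\<close>.
  Used in both directions, this gives uniqueness.\<close>

lemma le_if_disjoint_imp_disjoint:
  assumes "z \<in> Z" "z' \<in> Z"
    and imp: "\<And>y. y \<in> Z \<Longrightarrow> isGlb UNIV {y, z'} bot \<Longrightarrow> isGlb UNIV {y, z} bot"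
  shows "z \<le> z'"
proof -
  obtain w q r where w: "w \<in> Z" "isGlb UNIV {z', w} bot" "isLub UNIV {q, r} z" "q \<le> z'" "r \<le> w"
    using central_split[OF assms(2)] .
  have "isGlb UNIV {w, z} bot"
    using imp w(1,2) by (simp add: insert_commute)
  moreover have "r \<le> z"
    using w(3) by (auto simp: isLub_iff)
  ultimately have "r = bot"
    using w(5) by (simp add: isGlb_pair_bot_iff)
  then show ?thesis
    using w(3,4) by (auto simp: isLub_iff)
qed

section \<open>Suprema of covers of a \<open>Z\<close>-complete set\<close>

context
  fixes I :: "'a set"
  assumes complete: "Z_complete Z I"
begin

lemma Z_complete_Sup:
  assumes "S \<subseteq> I" "Z_disjoint Z S"
  obtains s where "s \<in> I" "isLub UNIV S s"
proof -
  have "\<exists>s\<in>I. isLub UNIV S s"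
    using complete[unfolded Z_complete_def, THEN conjunct1] assms by simp
  then show thesis
    by (elim bexE) (rule that)
qed

text \<open>The empty set is vacuously \<open>Z\<close>-disjoint, and its supremum is
  \<open>bot\<close>.\<close>

lemma bot_in_Z_complete: "bot \<in> I"
proof -
  obtain s where "s \<in> I" "isLub UNIV {} s"
    using Z_complete_Sup[of "{}"] by (auto simp: Z_disjoint_iff)
  moreover from this have "s = bot"
    by (metis isLub_iff UNIV_I bot_unique empty_iff)
  ultimately show ?thesis
    by simp
qed

lemma Z_complete_split:
  assumes "p \<in> I" "y \<in> Z"
  obtains w q r where "w \<in> Z" "isGlb UNIV {y, w} bot" "isLub UNIV {q, r} p" "q \<le> y" "r \<le> w"
    "q \<in> I" "r \<in> I"
proof -
  obtain w q r where w: "w \<in> Z" "isGlb UNIV {y, w} bot" "isLub UNIV {q, r} p" "q \<le> y" "r \<le> w"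
    using central_split[OF assms(2)] .
  then have "Z_disjoint Z {q, r}"
    by (intro Z_disjoint_pairI[OF assms(2)])
  then have "q \<in> I \<and> r \<in> I"
    using w(3) assms(1)
    by (intro complete[unfolded Z_complete_def, THEN conjunct2, rule_format] conjI bexI)
  then show thesis
    using that[OF w] by simp
qed

lemma Sup_Z_covers:
  assumes "S \<subseteq> I"
  obtains t where "t \<in> I" "isLub Z (Z_cover Z ` S) (Z_cover Z t)"
proof -
  \<comment> \<open>This choice makes every \<open>u \<in> Z\<close> above \<open>S\<close> an upper
    bound of \<open>T\<close>, hence of \<open>t\<close>.\<close>
  define A where "A = {p \<in> I. \<forall>u\<in>Z. (\<forall>s\<in>S. s \<le> u) \<longrightarrow> p \<le> u}"
  obtain T where T: "T \<subseteq> A" "Z_disjoint Z T"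
    and max: "\<forall>X\<subseteq>A. Z_disjoint Z X \<longrightarrow> T \<subseteq> X \<longrightarrow> X = T"
    by (rule maximal_Z_disjoint[of A])
  have "T \<subseteq> I"
    using T(1) by (auto simp: A_def)
  then obtain t where t: "t \<in> I" "isLub UNIV T t"
    using Z_complete_Sup T(2) by metis
  have T_le: "p \<le> t" if "p \<in> T" for p
    using t(2) that by (simp add: isLub_iff)
  have "s \<le> Z_cover Z t" if s: "s \<in> S" for s
  proof -
    obtain w q r where w: "w \<in> Z" "isGlb UNIV {Z_cover Z t, w} bot" "isLub UNIV {q, r} s"
      "q \<le> Z_cover Z t" "r \<le> w" "r \<in> I"
      by (rule Z_complete_split[OF subsetD[OF assms s] Z_cover_in])
    have r: "Z_cover Z r \<le> w"
      using w by (simp add: Z_cover_le_iff)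
    have "r \<le> s"
      using w(3) by (auto simp: isLub_iff)
    then have "r \<in> A"
      using s \<open>r \<in> I\<close> unfolding A_def mem_Collect_eq by (metis order_trans)
    \<comment> \<open>The two covers lie below the disjoint elements \<open>Z_cover Z t\<close> and
      \<open>w\<close>.\<close>
    moreover have "isGlb UNIV {Z_cover Z p, Z_cover Z r} bot" if "p \<in> T" for p
    proof -
      have "Z_cover Z p \<le> Z_cover Z t"
        using T_le[OF that] le_Z_cover[of t] by (simp add: Z_cover_le_iff Z_cover_in)
      then show ?thesis
        using w(2) r unfolding isGlb_pair_bot_iff by (metis order_trans)
    qed
    then have "Z_disjoint Z (insert r T)"
      using T(2) unfolding Z_disjoint_iff by (auto simp: insert_commute)
    \<comment> \<open>Maximality forces \<open>insert r T = T\<close>; then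
      \<open>r \<le> t\<close>, so both pieces of \<open>s\<close> lie below the cover of
      \<open>t\<close>.\<close>
    ultimately have "r \<in> T"
      using max[rule_format, of "insert r T"] T(1) by auto
    then have "r \<le> Z_cover Z t"
      using T_le le_Z_cover order_trans by metis
    then show ?thesis
      using w(3,4) by (auto simp: isLub_iff)
  qed
  moreover have "t \<le> u" if "u \<in> Z" "\<forall>s\<in>S. s \<le> u" for u
  proof -
    have "\<forall>p\<in>T. p \<le> u"
      using T(1) that unfolding A_def by blast
    then show ?thesis
      using t(2) by (simp add: isLub_iff)
  qed
  \<comment> \<open>An element of \<open>Z\<close> bounds a cover iff it bounds the covered
    element.\<close>
  ultimately have "isLub Z (Z_cover Z ` S) (Z_cover Z t)"
    by (auto simp: isLub_iff Z_cover_in Z_cover_le_iff)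
  with t(1) show thesis
    by (rule that)
qed

lemma disjoint_Sup_Z_covers_iff:
  assumes t: "t \<in> I" and lub: "isLub Z (Z_cover Z ` I) (Z_cover Z t)" and y: "y \<in> Z"
  shows "isGlb UNIV {y, Z_cover Z t} bot \<longleftrightarrow> {bot..y} \<inter> I = {bot}"
proof
  assume disj: "isGlb UNIV {y, Z_cover Z t} bot"
  have "p = bot" if "p \<in> I" "p \<le> y" for p
  proof -
    have "Z_cover Z p \<le> Z_cover Z t"
      using lub \<open>p \<in> I\<close> by (simp add: isLub_iff)
    with le_Z_cover have "p \<le> Z_cover Z t"
      by (rule order_trans)
    then show ?thesis
      using disj that by (simp add: isGlb_pair_bot_iff)
  qed
  then show "{bot..y} \<inter> I = {bot}"
    using bot_in_Z_complete by auto
next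
  assume trivial: "{bot..y} \<inter> I = {bot}"
  obtain w q r where w: "w \<in> Z" "isGlb UNIV {y, w} bot" "isLub UNIV {q, r} t"
    "q \<le> y" "r \<le> w" "q \<in> I"
    by (rule Z_complete_split[OF t y])
  have "q \<in> {bot..y} \<inter> I"
    using w(4,6) by simp
  then have "q = bot"
    unfolding trivial by simp
  \<comment> \<open>With \<open>q = bot\<close>, the supremum \<open>t\<close> of \<open>q\<close>
    and \<open>r\<close> is below \<open>w\<close>.\<close>
  then have "Z_cover Z t \<le> w"
    using w(1,3,5) by (auto simp: isLub_iff Z_cover_le_iff)
  then show "isGlb UNIV {y, Z_cover Z t} bot"
    using w(2) unfolding isGlb_pair_bot_iff by (metis order_trans)
qed

end

end

end

theorem theorem2p6:
  fixes Z I :: "'a::order_bot set"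
  assumes "lower_complete_sublattice Z"
    and "poset_central Z"
    and "Z_complete Z I"
  shows "upper_complete_sublattice_of Z (Z_cover Z ` I) \<and>
    (\<exists>z\<in>Z. isLub Z (Z_cover Z ` I) z \<and>
      (\<forall>y\<in>Z. isGlb UNIV {y, z} bot \<longleftrightarrow> {bot..y} \<inter> I = {bot}) \<and>
      (\<forall>z'\<in>Z. (\<forall>y\<in>Z. isGlb UNIV {y, z'} bot \<longleftrightarrow> {bot..y} \<inter> I = {bot}) \<longrightarrow> z' = z))"
proof
  show "upper_complete_sublattice_of Z (Z_cover Z ` I)"
    unfolding upper_complete_sublattice_of_def
  proof (intro conjI allI impI)
    show "Z_cover Z ` I \<subseteq> Z"
      using Z_cover_in[OF assms(1)] by blast
    fix J assume "J \<subseteq> Z_cover Z ` I"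
    then obtain S where "S \<subseteq> I" "J = Z_cover Z ` S"
      by (auto simp: subset_image_iff)
    then show "\<exists>x\<in>Z_cover Z ` I. isLub Z J x"
      using Sup_Z_covers[OF assms] by (metis imageI)
  qed
next
  \<comment> \<open>Taking \<open>S = I\<close> shows that the supremum is itself the cover of some
    \<open>t \<in> I\<close>, which can be split inside \<open>I\<close>.\<close>
  obtain t where t: "t \<in> I" "isLub Z (Z_cover Z ` I) (Z_cover Z t)"
    using Sup_Z_covers[OF assms order_refl] .
  have char: "isGlb UNIV {y, Z_cover Z t} bot \<longleftrightarrow> {bot..y} \<inter> I = {bot}" if "y \<in> Z" for y
    using disjoint_Sup_Z_covers_iff[OF assms t that] .
  have "z' = Z_cover Z t"
    if z': "z' \<in> Z" "\<forall>y\<in>Z. isGlb UNIV {y, z'} bot \<longleftrightarrow> {bot..y} \<inter> I = {bot}" for z'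
  proof (rule antisym)
    have iff: "isGlb UNIV {y, z'} bot \<longleftrightarrow> isGlb UNIV {y, Z_cover Z t} bot" if "y \<in> Z" for y
      using char that z'(2) by blast
    note le = le_if_disjoint_imp_disjoint[OF assms(1,2)]
    show "z' \<le> Z_cover Z t"
      by (rule le[OF z'(1) Z_cover_in[OF assms(1)]]) (simp only: iff)
    show "Z_cover Z t \<le> z'"
      by (rule le[OF Z_cover_in[OF assms(1)] z'(1)]) (simp only: iff)
  qed
  then show "\<exists>z\<in>Z. isLub Z (Z_cover Z ` I) z \<and>
      (\<forall>y\<in>Z. isGlb UNIV {y, z} bot \<longleftrightarrow> {bot..y} \<inter> I = {bot}) \<and>
      (\<forall>z'\<in>Z. (\<forall>y\<in>Z. isGlb UNIV {y, z'} bot \<longleftrightarrow> {bot..y} \<inter> I = {bot}) \<longrightarrow> z' = z)"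
    using t(2) char Z_cover_in[OF assms(1)] by blast
qed

end
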